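(* Let $0<\gamma\le 1$ be the discount factor and let $\mathcal S=\mathcal S_1\times\dots\times\mathcal S_d$, where each $\mathcal S_i$ is a finite set with $n$ elements. The value representation loses information: $\mathbb M_D\subsetneq\{M : V_M\in\mathbb V_D\}$. For any separable value function $V\in\mathbb V_D$ and any transition kernel $P\in\mathbb R^{n^d\times n^d}$ over states $\mathcal S$, there exists a vector of average rewards $r$ such that the value function of any MRP with transition kernel $P$ and average rewards $r$ is separable.
   Context: A Markov Reward Process (MRP) $M=(\mathcal S,P,R)$ consists of a state space $\mathcal S$, a transition kernel $P(s'\mid s)$ and a reward distribution $R(\cdot\mid s,s')$ for each transition, with mean $r(s,s')$. The vector of average rewards has entries $r(s)=\sum_{s'}P(s'\mid s)\,r(s,s')$. A trajectory is a Markovian sequence $(S^{(0)},R^{(1)},S^{(1)},R^{(2)},S^{(2)},\dots)$ of states and rewards, where $S^{(t+1)}\sim P(\cdot\mid S^{(t)})$ and $R^{(t+1)}\sim R(\cdot\mid S^{(t)},S^{(t+1)})$. The value function of $M$ with discount factor $\gamma$ is the expected discounted sum of rewards along a trajectory, $V_M(s)=\mathbb E\big[\sum_{t=0}^\infty\gamma^t r(S^{(t)},S^{(t+1)})\mid S^{(0)}=s\big]$. An MRP on $\mathcal S=\mathcal S_1\times\dots\times\mathcal S_d$ is $d$-decoupled if there are transition kernels $P_1,\dots,P_d$ and reward kernels $R_1,\dots,R_d$ (on $\mathcal S_1,\dots,\mathcal S_d$, with means $r_1,\dots,r_d$) such that for all $s,s'\in\mathcal S$, $P(s'\mid s)=\prod_{i=1}^d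 P_i(s_i'\mid s_i)$ and $r(s,s')=\sum_{i=1}^d r_i(s_i,s_i')$. $\mathbb M_D$ denotes the set of decoupled MRPs. $\mathbb V_D$ denotes the set of separable value functions, i.e. functions $V$ on $\mathcal S$ for which there exist $V_1,\dots,V_d$ with $V(s)=\sum_{i=1}^d V_i(s_i)$ for all $s\in\mathcal S$.
   Formalization: Strictness of the inclusion is claimed only for d ≥ 2 and n ≥ 2 (for d = 1 or n = 1 every MRP with a value function is decoupled, so it fails); for γ = 1 only MRPs whose value function exists are considered (e.g. P = identity, r = 1 has none). *)

theory Defs
  imports "HOL-Probability.Probability"
begin

section \<open>Markov reward processes\<close>

text \<open>
  The state space is an explicit carrier set \<open>S\<close>. Transition rows are probability mass functions
  and rewards are probability measures on the reals with finite mean. Values outside of \<open>S\<close> are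
  irrelevant.
\<close>

record 's mrp =
  trans :: "'s \<Rightarrow> 's pmf"
  rew :: "'s \<Rightarrow> 's \<Rightarrow> real measure"

definition is_kernel :: "'s set \<Rightarrow> ('s \<Rightarrow> 's pmf) \<Rightarrow> bool" where
  "is_kernel S P \<longleftrightarrow> (\<forall>s\<in>S. set_pmf (P s) \<subseteq> S)"

definition mrps :: "'s set \<Rightarrow> 's mrp set" where
  "mrps S = {M. is_kernel S (trans M) \<and>
     (\<forall>s\<in>S. \<forall>s'\<in>S. prob_space (rew M s s') \<and> sets (rew M s s') = sets borel
        \<and> integrable (rew M s s') (\<lambda>x. x))}"

definition mean_rew :: "'s mrp \<Rightarrow> 's \<Rightarrow> 's \<Rightarrow> real" where
  "mean_rew M s s' = (\<integral>x. x \<partial>rew M s s')"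

definition avg_rew :: "'s set \<Rightarrow> 's mrp \<Rightarrow> 's \<Rightarrow> real" where
  "avg_rew S M s = (\<Sum>s'\<in>S. pmf (trans M s) s' * mean_rew M s s')"

definition mrps_with :: "'s set \<Rightarrow> ('s \<Rightarrow> 's pmf) \<Rightarrow> ('s \<Rightarrow> real) \<Rightarrow> 's mrp set" where
  "mrps_with S P r = {M \<in> mrps S. \<forall>s\<in>S. trans M s = P s \<and> avg_rew S M s = r s}"


section \<open>Trajectories and value functions\<close>

text \<open>
  \<open>traj S P s\<close> is the law, on the sequences in \<open>S\<close>, of the state component
  of a trajectory started in \<open>s\<close>. It is the Ionescu-Tulcea measure: the state at time 0 is \<open>s\<close>, and
  given the states up to time \<open>t\<close> the state at time \<open>t + 1\<close> has law \<open>P (\<omega> t)\<close>; the lemma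
  \<open>emeasure_traj\<close> below gives its cylinder probabilities. The sampled
  rewards are not recorded because the value function depends on them only through their means.
\<close>

definition traj_step :: "'s set \<Rightarrow> ('s \<Rightarrow> 's pmf) \<Rightarrow> 's \<Rightarrow> nat \<Rightarrow> (nat \<Rightarrow> 's) \<Rightarrow> 's measure" where
  "traj_step S P s t \<omega> = (case t of 0 \<Rightarrow> return (count_space S) s
     | Suc u \<Rightarrow> restrict_space (measure_pmf (P (\<omega> u))) S)"

definition traj :: "'s set \<Rightarrow> ('s \<Rightarrow> 's pmf) \<Rightarrow> 's \<Rightarrow> (nat \<Rightarrow> 's) measure" where
  "traj S P s = projective_family.lim UNIV
     (Ionescu_Tulcea.CI (traj_step S P s) (\<lambda>_. count_space S)) (\<lambda>_. count_space S)"

text \<open>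
  For discount factor 1 the expected sum of rewards need not exist (the series may diverge, or its
  sum may fail to be integrable). Since \<open>suminf\<close> and the Bochner integral are total, existence is
  recorded separately in \<open>value_defined\<close>.
\<close>

definition disc_rew :: "real \<Rightarrow> 's mrp \<Rightarrow> (nat \<Rightarrow> 's) \<Rightarrow> nat \<Rightarrow> real" where
  "disc_rew \<gamma> M \<omega> t = \<gamma> ^ t * mean_rew M (\<omega> t) (\<omega> (Suc t))"

definition value_defined :: "real \<Rightarrow> 's set \<Rightarrow> 's mrp \<Rightarrow> bool" where
  "value_defined \<gamma> S M \<longleftrightarrow> (\<forall>s\<in>S.
     (AE \<omega> in traj S (trans M) s. summable (disc_rew \<gamma> M \<omega>)) \<and>
     integrable (traj S (trans M) s) (\<lambda>\<omega>. \<Sum>t. disc_rew \<gamma> M \<omega> t))"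

definition value_fun :: "real \<Rightarrow> 's set \<Rightarrow> 's mrp \<Rightarrow> 's \<Rightarrow> real" where
  "value_fun \<gamma> S M s = (\<integral>\<omega>. (\<Sum>t. disc_rew \<gamma> M \<omega> t) \<partial>traj S (trans M) s)"


section \<open>Decoupled processes and separable functions\<close>

abbreviation prod_states :: "nat \<Rightarrow> (nat \<Rightarrow> 'a set) \<Rightarrow> (nat \<Rightarrow> 'a) set" where
  "prod_states d A \<equiv> (\<Pi>\<^sub>E i\<in>{..<d}. A i)"

definition decoupled :: "nat \<Rightarrow> (nat \<Rightarrow> 'a set) \<Rightarrow> (nat \<Rightarrow> 'a) mrp set" where
  "decoupled d A = {M \<in> mrps (prod_states d A).
     \<exists>N :: nat \<Rightarrow> 'a mrp. (\<forall>i<d. N i \<in> mrps (A i)) \<and>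
       (\<forall>s\<in>prod_states d A. \<forall>s'\<in>prod_states d A.
          pmf (trans M s) s' = (\<Prod>i<d. pmf (trans (N i) (s i)) (s' i)) \<and>
          mean_rew M s s' = (\<Sum>i<d. mean_rew (N i) (s i) (s' i)))}"

definition separable :: "nat \<Rightarrow> (nat \<Rightarrow> 'a set) \<Rightarrow> ((nat \<Rightarrow> 'a) \<Rightarrow> real) set" where
  "separable d A = {V. \<exists>W :: nat \<Rightarrow> 'a \<Rightarrow> real. \<forall>s\<in>prod_states d A. V s = (\<Sum>i<d. W i (s i))}"


section \<open>The trajectory law\<close>

lemma Ionescu_Tulcea_traj:
  fixes S :: "'s set"
  assumes P: "is_kernel S P" and s: "s \<in> S"
  shows "Ionescu_Tulcea (traj_step S P s) (\<lambda>_. count_space S)"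
proof (rule Ionescu_Tulcea.intro)
  have R: "restrict_space (measure_pmf (P x)) S \<in> space (subprob_algebra (count_space S))"
    "prob_space (restrict_space (measure_pmf (P x)) S)" if "x \<in> S" for x
  proof -
    have "emeasure (measure_pmf (P x)) S = 1"
      using P that measure_pmf.emeasure_eq_1_AE[of S "P x"]
      by (auto simp: is_kernel_def AE_measure_pmf_iff)
    then show ps: "prob_space (restrict_space (measure_pmf (P x)) S)"
      by (intro prob_spaceI) (simp add: emeasure_restrict_space space_restrict_space)
    show "restrict_space (measure_pmf (P x)) S \<in> space (subprob_algebra (count_space S))"
      using ps by (auto simp: space_subprob_algebra sets_restrict_space
          intro: prob_space_imp_subprob_space)
  qed
  show "traj_step S P s i \<in> Pi\<^sub>M {0..<i} (\<lambda>_. count_space S) \<rightarrow>\<^sub>M subprob_algebra (count_space S)" for i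
  proof (cases i)
    case 0
    have "return (count_space S) s \<in> space (subprob_algebra (count_space S))"
      using s by (auto simp: space_subprob_algebra
          intro!: prob_space_imp_subprob_space prob_space_return)
    then show ?thesis
      unfolding traj_step_def[abs_def] 0 by simp
  next
    case (Suc u)
    have "(\<lambda>\<omega>. \<omega> u) \<in> Pi\<^sub>M {0..<i} (\<lambda>_. count_space S) \<rightarrow>\<^sub>M count_space S"
      using Suc by (intro measurable_component_singleton) auto
    moreover have "(\<lambda>x. restrict_space (measure_pmf (P x)) S)
        \<in> count_space S \<rightarrow>\<^sub>M subprob_algebra (count_space S)"
      using R(1) by simp
    ultimately show ?thesis
      unfolding traj_step_def[abs_def] Suc nat.case by (rule measurable_compose)
  qed
  fix i :: nat and \<omega> :: "nat \<Rightarrow> 's"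
  assume "\<omega> \<in> space (Pi\<^sub>M {0..<i} (\<lambda>_. count_space S))"
  then show "prob_space (traj_step S P s i \<omega>)"
    using s R(2) by (cases i) (auto simp: traj_step_def space_PiM PiE_iff intro!: prob_space_return)
qed

lemma
  fixes S :: "'s set"
  assumes P: "is_kernel S P" and s: "s \<in> S"
  shows prob_space_traj: "prob_space (traj S P s)"
    and sets_traj: "sets (traj S P s) = sets (Pi\<^sub>M UNIV (\<lambda>_. count_space S))"
    and emeasure_traj: "\<And>w T. (\<And>t. t \<le> T \<Longrightarrow> w t \<in> S) \<Longrightarrow>
      emeasure (traj S P s) {\<omega> \<in> space (traj S P s). \<forall>t\<le>T. \<omega> t = w t} =
      (if w 0 = s then ennreal (\<Prod>t<T. pmf (P (w t)) (w (Suc t))) else 0)"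
proof -
  interpret IT: Ionescu_Tulcea "traj_step S P s" "\<lambda>_. count_space S"
    by (rule Ionescu_Tulcea_traj[OF P s])
  have tr: "traj S P s = IT.PF.lim"
    by (simp add: traj_def)
  show sets: "sets (traj S P s) = sets (Pi\<^sub>M UNIV (\<lambda>_. count_space S))"
    by (simp add: tr)
  have sp: "space (traj S P s) = space (Pi\<^sub>M UNIV (\<lambda>_. count_space S))"
    using sets by (rule sets_eq_imp_space_eq)
  have lim: "emeasure (traj S P s) (IT.PF.emb UNIV {0..<k} X) = emeasure (IT.C 0 k (\<lambda>_. undefined)) X"
    if "X \<in> sets (Pi\<^sub>M {0..<k} (\<lambda>_. count_space S))" for k X
  proof -
    have "IT.PF.emb {0..<k} {0..<k} X = X"
      using sets.sets_into_space[OF that] by (intro prod_emb_id) (simp add: space_PiM)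
    then show ?thesis
      using that by (simp add: tr IT.lim IT.emeasure_CI[of _ k])
  qed
  show "prob_space (traj S P s)"
  proof
    have "emeasure (traj S P s) (IT.PF.emb UNIV {0..<0} {\<lambda>_. undefined}) =
        emeasure (IT.C 0 0 (\<lambda>_. undefined)) {\<lambda>_. undefined}"
      by (rule lim) (simp add: sets_PiM_empty)
    also have "IT.PF.emb UNIV {0..<0} {\<lambda>_. undefined} = space (traj S P s)"
      by (auto simp: prod_emb_def sp space_PiM)
    also have "emeasure (IT.C 0 0 (\<lambda>_. undefined)) {\<lambda>_. undefined} = 1"
      by (simp add: sets_PiM_empty)
    finally show "emeasure (traj S P s) (space (traj S P s)) = 1" .
  qed
  fix w :: "nat \<Rightarrow> 's" and T :: nat
  assume w: "\<And>t. t \<le> T \<Longrightarrow> w t \<in> S"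
  let ?w = "\<lambda>k. restrict w {0..<k}"
  have wS: "{?w k} \<in> sets (Pi\<^sub>M {0..<k} (\<lambda>_. count_space S))" if "k \<le> Suc T" for k
  proof -
    have "(\<Pi>\<^sub>E t\<in>{0..<k}. {w t}) \<in> sets (Pi\<^sub>M {0..<k} (\<lambda>_. count_space S))"
      using w that by (intro sets_PiM_I_finite) auto
    moreover have "(\<Pi>\<^sub>E t\<in>{0..<k}. {w t}) = {?w k}"
      by (auto simp: PiE_iff extensional_def fun_eq_iff)
    ultimately show ?thesis by simp
  qed
  have wsp: "?w k \<in> space (Pi\<^sub>M {0..<k} (\<lambda>_. count_space S))" if "k \<le> Suc T" for k
    using sets.sets_into_space[OF wS[OF that]] by simp
  have step: "emeasure (IT.C 0 (Suc k) (\<lambda>_. undefined)) {?w (Suc k)} =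
      emeasure (IT.C 0 k (\<lambda>_. undefined)) {?w k} * emeasure (traj_step S P s k (?w k)) {w k}"
    if k: "k \<le> T" for k
  proof -
    have "emeasure (IT.C 0 (Suc k) (\<lambda>_. undefined)) {?w (Suc k)} =
        (\<integral>\<^sup>+x. emeasure (IT.eP k x) {?w (Suc k)} \<partial>IT.C 0 k (\<lambda>_. undefined))"
    proof -
      have "space (IT.C 0 k (\<lambda>_. undefined)) \<noteq> {}"
        using IT.prob_space_C[of "\<lambda>_. undefined" 0 k, THEN prob_space.not_empty] by simp
      moreover have "IT.eP k \<in> IT.C 0 k (\<lambda>_. undefined)
          \<rightarrow>\<^sub>M subprob_algebra (Pi\<^sub>M {0..<Suc k} (\<lambda>_. count_space S))"
        using IT.measurable_eP[of k] IT.sets_C[of "\<lambda>_. undefined" 0 k]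
        by (subst measurable_cong_sets[OF _ refl]) auto
      ultimately show ?thesis
        using emeasure_bind[OF _ _ wS[of "Suc k"]] k by simp
    qed
    also have "\<dots> = (\<integral>\<^sup>+x. emeasure (traj_step S P s k (?w k)) {w k} * indicator {?w k} x
        \<partial>IT.C 0 k (\<lambda>_. undefined))"
    proof (rule nn_integral_cong)
      fix x assume "x \<in> space (IT.C 0 k (\<lambda>_. undefined))"
      then have x: "x \<in> space (Pi\<^sub>M {0..<k} (\<lambda>_. count_space S))"
        by (simp add: IT.space_C)
      have "fun_upd x k -` {?w (Suc k)} \<inter> S = (if x = ?w k then {w k} else {})"
      proof -
        have "x(k := y) = ?w (Suc k) \<longleftrightarrow> x = ?w k \<and> y = w k" for y
          using x by (auto simp: fun_eq_iff space_PiM PiE_iff extensional_def less_Suc_eq)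
        then show ?thesis using w[OF k] by auto
      qed
      then show "emeasure (IT.eP k x) {?w (Suc k)} =
          emeasure (traj_step S P s k (?w k)) {w k} * indicator {?w k} x"
        using IT.emeasure_eP[OF x wS[of "Suc k"]] k by simp
    qed
    also have "\<dots> = emeasure (traj_step S P s k (?w k)) {w k} *
        emeasure (IT.C 0 k (\<lambda>_. undefined)) {?w k}"
      using wS[of k] k by (intro nn_integral_cmult_indicator) (simp add: IT.sets_C)
    finally show ?thesis by (simp add: mult.commute)
  qed
  have C: "emeasure (IT.C 0 (Suc k) (\<lambda>_. undefined)) {?w (Suc k)} =
      (if w 0 = s then ennreal (\<Prod>t<k. pmf (P (w t)) (w (Suc t))) else 0)" if "k \<le> T" for k
    using that
  proof (induction k)
    case 0
    have "?w 0 = (\<lambda>_. undefined)"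
      by (simp add: fun_eq_iff)
    then have "emeasure (IT.C 0 0 (\<lambda>_. undefined)) {?w 0} = 1"
      using wS[of 0] by simp
    moreover have "emeasure (traj_step S P s 0 (?w 0)) {w 0} = (if w 0 = s then 1 else 0)"
      using w[of 0] by (auto simp: traj_step_def indicator_def)
    ultimately have "emeasure (IT.C 0 (Suc 0) (\<lambda>_. undefined)) {?w (Suc 0)} = (if w 0 = s then 1 else 0)"
      unfolding step[OF le0] by simp
    then show ?case
      unfolding lessThan_0 prod.empty ennreal_1 .
  next
    case (Suc k)
    have "emeasure (traj_step S P s (Suc k) (?w (Suc k))) {w (Suc k)} = pmf (P (w k)) (w (Suc k))"
      using w[of "Suc k"] Suc.prems
      by (simp add: traj_step_def emeasure_restrict_space emeasure_pmf_single)
    moreover have "emeasure (IT.C 0 (Suc k) (\<lambda>_. undefined)) {?w (Suc k)} =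
        (if w 0 = s then ennreal (\<Prod>t<k. pmf (P (w t)) (w (Suc t))) else 0)"
      using Suc.prems by (intro Suc.IH) simp
    ultimately show ?case
      unfolding step[OF Suc.prems] by (simp add: ennreal_mult'' prod_nonneg)
  qed
  have "{\<omega> \<in> space (traj S P s). \<forall>t\<le>T. \<omega> t = w t} = IT.PF.emb UNIV {0..<Suc T} {?w (Suc T)}"
  proof -
    have "(\<forall>t\<le>T. \<omega> t = w t) \<longleftrightarrow> restrict \<omega> {0..<Suc T} = ?w (Suc T)" for \<omega>
      by (metis (mono_tags, lifting) atLeastLessThan_iff le0 less_Suc_eq_le restrict_apply' restrict_ext)
    then show ?thesis
      by (auto simp: prod_emb_def sp space_PiM)
  qed
  then show "emeasure (traj S P s) {\<omega> \<in> space (traj S P s). \<forall>t\<le>T. \<omega> t = w t} =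
      (if w 0 = s then ennreal (\<Prod>t<T. pmf (P (w t)) (w (Suc t))) else 0)"
    using lim[OF wS[of "Suc T"]] C[of T] by (simp del: IT.C.simps)
qed

end

theory Submission
  imports Defs
begin

text \<open>
  The law of the shifted trajectory is the mixture, over the first transition, of the trajectory
  laws; hence a value function satisfies the Bellman equation \<open>V = r + \<gamma> K V\<close> for the transition
  operator \<open>K\<close>. Moreover \<open>\<gamma>\<^sup>T K\<^sup>T V\<close> tends to \<open>0\<close>, even for \<open>\<gamma> = 1\<close> as soon as the value is defined,
  so \<open>V\<close> is the limit of the partial sums of \<open>\<gamma>\<^sup>t K\<^sup>t r\<close>. For a decoupled process \<open>r\<close> is separable
  and \<open>K\<close> preserves separability, and separable functions are closed under limits. The
  inclusion is strict because zero rewards give value \<open>0\<close> for every kernel, for instance for the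
  uniform law on two states that differ in every coordinate. Given a separable \<open>V\<close> and a kernel, \<open>r = V - \<gamma> K V\<close> works for
  \<open>\<gamma> < 1\<close> and \<open>r = 0\<close> for \<open>\<gamma> = 1\<close>.
\<close>

section \<open>The Markov property\<close>

lemma measurable_shift:
  "(\<lambda>\<omega> t. \<omega> (t + k)) \<in> Pi\<^sub>M UNIV (\<lambda>_::nat. M) \<rightarrow>\<^sub>M Pi\<^sub>M UNIV (\<lambda>_::nat. M)"
  by (rule measurable_PiM_single') (auto simp: space_PiM PiE_iff)

text \<open>The index map \<open>g\<close> lets the lemma serve both for cylinders at the times
  \<open>t\<close> and for those at the times \<open>Suc t\<close>.\<close>

lemma sets_cylinder:
  assumes M: "sets M = sets (Pi\<^sub>M UNIV (\<lambda>_::nat. count_space S))"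
    and "\<And>t. t \<le> T \<Longrightarrow> w t \<in> S"
  shows "{\<omega> \<in> space M. \<forall>t\<le>T. \<omega> (g t :: nat) = w (t :: nat)} \<in> sets M"
proof -
  have "{\<omega> \<in> space M. \<forall>t\<le>T. \<omega> (g t) = w t} = {\<omega> \<in> space M. \<forall>t\<in>{..T}. \<omega> (g t) = w t}"
    by auto
  also have "\<dots> \<in> sets M"
  proof (intro sets.sets_Collect_finite_All)
    fix t assume "t \<in> {..T}"
    then have "{w t} \<in> sets (count_space S)"
      using assms(2) by simp
    moreover have "(\<lambda>\<omega>. \<omega> (g t)) \<in> M \<rightarrow>\<^sub>M count_space S"
      by (subst measurable_cong_sets[OF M refl]) simp
    ultimately have "(\<lambda>\<omega>. \<omega> (g t)) -` {w t} \<inter> space M \<in> sets M"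
      by (metis measurable_sets)
    also have "(\<lambda>\<omega>. \<omega> (g t)) -` {w t} \<inter> space M = {\<omega> \<in> space M. \<omega> (g t) = w t}"
      by auto
    finally show "{\<omega> \<in> space M. \<omega> (g t) = w t} \<in> sets M" .
  qed auto
  finally show ?thesis .
qed

text \<open>Since \<open>S\<close> is finite, each generator of the product sigma-algebra is a
  finite disjoint union of cylinders that fix all coordinates up to some \<open>T\<close>, so the
  cylinder probabilities determine the measure.\<close>

lemma measure_eqI_cylinders:
  fixes S :: "'s set"
  assumes "finite S"
    and P: "sets P = sets (Pi\<^sub>M UNIV (\<lambda>_::nat. count_space S))"
    and Q: "sets Q = sets (Pi\<^sub>M UNIV (\<lambda>_::nat. count_space S))"
    and "finite_measure P"
    and eq: "\<And>w T. (\<And>t. t \<le> T \<Longrightarrow> w t \<in> S) \<Longrightarrow>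
      emeasure P {\<omega> \<in> space P. \<forall>t\<le>T. \<omega> t = w t} = emeasure Q {\<omega> \<in> space Q. \<forall>t\<le>T. \<omega> t = w t}"
  shows "P = Q"
proof (rule measure_eqI_PiM_infinite[OF P Q _ \<open>finite_measure P\<close>])
  fix B :: "nat \<Rightarrow> 's set" and J :: "nat set"
  assume "finite J" and B: "\<And>i. i \<in> J \<Longrightarrow> B i \<in> sets (count_space S)"
  then obtain T where T: "J \<subseteq> {..T}"
    using finite_nat_iff_bounded_le by blast
  define W where "W = {w \<in> {..T} \<rightarrow>\<^sub>E S. \<forall>j\<in>J. w j \<in> B j}"
  have "finite W"
    unfolding W_def using \<open>finite S\<close> by (intro finite_subset[OF _ finite_PiE[of "{..T}" "\<lambda>_. S"]]) auto
  let ?E = "prod_emb UNIV (\<lambda>_. count_space S) J (Pi\<^sub>E J B)"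
  have *: "emeasure M ?E = (\<Sum>w\<in>W. emeasure M {\<omega> \<in> space M. \<forall>t\<le>T. \<omega> t = w t})"
    if M: "sets M = sets (Pi\<^sub>M UNIV (\<lambda>_::nat. count_space S))" for M
  proof -
    have sp: "space M = (\<Pi>\<^sub>E _\<in>UNIV. S)"
      using sets_eq_imp_space_eq[OF M] by (simp add: space_PiM)
    have "?E = (\<Union>w\<in>W. {\<omega> \<in> space M. \<forall>t\<le>T. \<omega> t = w t})"
    proof (intro equalityI subsetI)
      fix \<omega> assume \<omega>: "\<omega> \<in> ?E"
      then have "restrict \<omega> {..T} \<in> W"
        using T by (auto simp: W_def prod_emb_def PiE_iff)
      moreover have "\<omega> \<in> {\<omega>' \<in> space M. \<forall>t\<le>T. \<omega>' t = restrict \<omega> {..T} t}"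
        using \<omega> by (auto simp: sp prod_emb_def PiE_iff)
      ultimately show "\<omega> \<in> (\<Union>w\<in>W. {\<omega> \<in> space M. \<forall>t\<le>T. \<omega> t = w t})" by blast
    next
      fix \<omega> assume "\<omega> \<in> (\<Union>w\<in>W. {\<omega> \<in> space M. \<forall>t\<le>T. \<omega> t = w t})"
      then show "\<omega> \<in> ?E"
        using T by (auto simp: W_def prod_emb_def sp PiE_iff subset_iff)
    qed
    moreover have "disjoint_family_on (\<lambda>w. {\<omega> \<in> space M. \<forall>t\<le>T. \<omega> t = w t}) W"
      unfolding disjoint_family_on_def W_def by (auto intro!: PiE_ext)
    moreover have "(\<lambda>w. {\<omega> \<in> space M. \<forall>t\<le>T. \<omega> t = w t}) ` W \<subseteq> sets M"
    proof (rule image_subsetI)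
      fix w assume "w \<in> W"
      then show "{\<omega> \<in> space M. \<forall>t\<le>T. \<omega> t = w t} \<in> sets M"
        by (intro sets_cylinder[OF M]) (simp add: W_def PiE_iff)
    qed
    ultimately show ?thesis
      using sum_emeasure[of _ W M] \<open>finite W\<close> by simp
  qed
  show "emeasure P ?E = emeasure Q ?E"
    unfolding *[OF P] *[OF Q] by (intro sum.cong refl eq) (auto simp: W_def)
qed

text \<open>The mixture identity is at hand for nonnegative integrals; splitting \<open>f\<close>
  into positive and negative part transfers it to the Bochner integral. In the application
  \<open>h\<close> is the shift and the \<open>c i\<close> are transition probabilities.\<close>

lemma integral_finite_mixture:
  fixes f :: "'a \<Rightarrow> real"
  assumes "finite I" and c: "\<And>i. i \<in> I \<Longrightarrow> 0 \<le> c i"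
    and int: "\<And>i. i \<in> I \<Longrightarrow> integrable (N i) f"
    and h: "h \<in> M \<rightarrow>\<^sub>M L" and f: "f \<in> borel_measurable L"
    and eq: "\<And>u. u \<in> borel_measurable L \<Longrightarrow>
      (\<integral>\<^sup>+x. u (h x) \<partial>M) = (\<Sum>i\<in>I. ennreal (c i) * (\<integral>\<^sup>+x. u x \<partial>N i))"
  shows "integrable M (\<lambda>x. f (h x))" "(\<integral>x. f (h x) \<partial>M) = (\<Sum>i\<in>I. c i * (\<integral>x. f x \<partial>N i))"
proof -
  have [measurable]: "(\<lambda>x. f (h x)) \<in> borel_measurable M"
    using h f by (rule measurable_compose)
  have fin: "(\<integral>\<^sup>+x. ennreal (norm (f x)) \<partial>N i) < \<infinity>" if "i \<in> I" for i
    using int[OF that] by (simp add: integrable_iff_bounded)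
  \<comment> \<open>\<open>k\<close> will be \<open>norm\<close>, the identity and
    \<open>uminus\<close>. As \<open>ennreal\<close> sends negative numbers to 0, the last two
    produce the positive and the negative part of \<open>f\<close>; the bound by \<open>norm\<close>
    keeps all integrals finite.\<close>
  have part: "(\<integral>\<^sup>+x. ennreal (k (f (h x))) \<partial>M) = ennreal (\<Sum>i\<in>I. c i * enn2real (\<integral>\<^sup>+x. ennreal (k (f x)) \<partial>N i))"
    if k[measurable]: "k \<in> borel_measurable borel" and kn: "\<And>x. k x \<le> norm x" for k :: "real \<Rightarrow> real"
  proof -
    have "(\<lambda>x. ennreal (k (f x))) \<in> borel_measurable L"
      using f by measurable
    then have "(\<integral>\<^sup>+x. ennreal (k (f (h x))) \<partial>M) = (\<Sum>i\<in>I. ennreal (c i) * (\<integral>\<^sup>+x. ennreal (k (f x)) \<partial>N i))"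
      by (rule eq)
    also have "\<dots> = (\<Sum>i\<in>I. ennreal (c i * enn2real (\<integral>\<^sup>+x. ennreal (k (f x)) \<partial>N i)))"
    proof (rule sum.cong[OF refl])
      fix i assume i: "i \<in> I"
      have "(\<integral>\<^sup>+x. ennreal (k (f x)) \<partial>N i) \<le> (\<integral>\<^sup>+x. ennreal (norm (f x)) \<partial>N i)"
        by (intro nn_integral_mono ennreal_leI kn)
      then have "(\<integral>\<^sup>+x. ennreal (k (f x)) \<partial>N i) < top"
        using fin[OF i] by (auto intro: le_less_trans)
      then show "ennreal (c i) * (\<integral>\<^sup>+x. ennreal (k (f x)) \<partial>N i) =
          ennreal (c i * enn2real (\<integral>\<^sup>+x. ennreal (k (f x)) \<partial>N i))"
        using c[OF i] by (simp add: ennreal_mult ennreal_enn2real_if less_top)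
    qed
    also have "\<dots> = ennreal (\<Sum>i\<in>I. c i * enn2real (\<integral>\<^sup>+x. ennreal (k (f x)) \<partial>N i))"
      using c by (intro sum_ennreal) simp
    finally show ?thesis .
  qed
  show int': "integrable M (\<lambda>x. f (h x))"
    using part[of norm] by (intro integrableI_bounded) (auto simp: less_top[symmetric])
  have "(\<integral>x. f (h x) \<partial>M) = (\<Sum>i\<in>I. c i * enn2real (\<integral>\<^sup>+x. ennreal (f x) \<partial>N i))
      - (\<Sum>i\<in>I. c i * enn2real (\<integral>\<^sup>+x. ennreal (- f x) \<partial>N i))"
    unfolding real_lebesgue_integral_def[OF int']
    using part[of "\<lambda>x. x"] part[of uminus] c by (simp add: sum_nonneg)
  also have "\<dots> = (\<Sum>i\<in>I. c i * (\<integral>x. f x \<partial>N i))"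
    by (simp add: real_lebesgue_integral_def int right_diff_distrib sum_subtractf cong: sum.cong)
  finally show "(\<integral>x. f (h x) \<partial>M) = (\<Sum>i\<in>I. c i * (\<integral>x. f x \<partial>N i))" .
qed

section \<open>The transition operator of a finite chain\<close>

locale finite_chain =
  fixes S :: "'s set" and P :: "'s \<Rightarrow> 's pmf"
  assumes finite_S: "finite S" and kernel: "is_kernel S P"
begin

abbreviation shift :: "nat \<Rightarrow> (nat \<Rightarrow> 's) \<Rightarrow> (nat \<Rightarrow> 's)" where
  "shift k \<omega> \<equiv> (\<lambda>t. \<omega> (t + k))"

abbreviation paths :: "(nat \<Rightarrow> 's) measure" where
  "paths \<equiv> Pi\<^sub>M UNIV (\<lambda>_. count_space S)"

text \<open>The Markov operator: the expectation of \<open>f\<close> at the state after one step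
  from \<open>s\<close>. Only the values of \<open>f\<close> on \<open>S\<close> enter, hence the
  congruence rules below.\<close>

definition K :: "('s \<Rightarrow> real) \<Rightarrow> 's \<Rightarrow> real" where
  "K f s = (\<Sum>s'\<in>S. pmf (P s) s' * f s')"

lemma K_cong: "(\<And>s'. s' \<in> S \<Longrightarrow> f s' = g s') \<Longrightarrow> K f s = K g s"
  by (simp add: K_def)

lemma K_pow_cong:
  assumes "\<And>s'. s' \<in> S \<Longrightarrow> f s' = g s'" and "s \<in> S"
  shows "(K ^^ n) f s = (K ^^ n) g s"
  using \<open>s \<in> S\<close> by (induction n arbitrary: s) (auto intro!: K_cong simp: assms)

lemma K_add_scaled: "K (\<lambda>s. f s + c * g s) = (\<lambda>s. K f s + c * K g s)"
  by (simp add: fun_eq_iff K_def sum.distrib sum_distrib_left algebra_simps)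

lemma K_pow_add_scaled: "(K ^^ n) (\<lambda>s. f s + c * g s) = (\<lambda>s. (K ^^ n) f s + c * (K ^^ n) g s)"
  by (induction n) (simp_all add: K_add_scaled)

text \<open>\<open>K\<close> is linear with nonnegative weights, so bounds pass through its powers.
  The constant weight 1 shows that \<open>K\<close> does not increase the maximum norm; a
  nonconstant weight is used for \<open>\<gamma> = 1\<close>.\<close>

lemma K_pow_abs_le:
  assumes "\<And>s'. s' \<in> S \<Longrightarrow> \<bar>f s'\<bar> \<le> c * g s'" and "s \<in> S"
  shows "\<bar>(K ^^ n) f s\<bar> \<le> c * (K ^^ n) g s"
  using \<open>s \<in> S\<close>
proof (induction n arbitrary: s)
  case (Suc n)
  have "\<bar>K ((K ^^ n) f) s\<bar> \<le> (\<Sum>s'\<in>S. \<bar>pmf (P s) s' * (K ^^ n) f s'\<bar>)"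
    by (simp add: K_def sum_abs)
  also have "\<dots> \<le> (\<Sum>s'\<in>S. c * (pmf (P s) s' * (K ^^ n) g s'))"
  proof (rule sum_mono)
    fix s' assume "s' \<in> S"
    then have "pmf (P s) s' * \<bar>(K ^^ n) f s'\<bar> \<le> pmf (P s) s' * (c * (K ^^ n) g s')"
      by (intro mult_left_mono Suc.IH) auto
    then show "\<bar>pmf (P s) s' * (K ^^ n) f s'\<bar> \<le> c * (pmf (P s) s' * (K ^^ n) g s')"
      by (simp add: abs_mult mult_ac)
  qed
  also have "\<dots> = c * K ((K ^^ n) g) s"
    by (simp add: K_def sum_distrib_left)
  finally show ?case
    by simp
qed (simp add: assms)

lemma sum_kernel: "s \<in> S \<Longrightarrow> (\<Sum>s'\<in>S. pmf (P s) s') = 1"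
  using kernel finite_S by (intro sum_pmf_eq_1) (auto simp: is_kernel_def)

lemma K_pow_const: "s \<in> S \<Longrightarrow> (K ^^ n) (\<lambda>_. c) s = c"
proof (induction n arbitrary: s)
  case (Suc n)
  have "K (\<lambda>_. c) s = c"
    using Suc.prems by (simp add: K_def sum_kernel flip: sum_distrib_right)
  then show ?case
    using Suc.IH K_cong[of "(K ^^ n) (\<lambda>_. c)" "\<lambda>_. c" s] by simp
qed simp

text \<open>\<open>K\<close> does not increase the maximum norm, so the largest
  \<open>\<bar>D s\<bar>\<close> on \<open>S\<close>, which is attained, is at most
  \<open>\<gamma>\<close> times itself.\<close>

lemma discounted_fixpoint_unique:
  assumes \<gamma>: "0 \<le> \<gamma>" "\<gamma> < 1" and D: "\<And>s. s \<in> S \<Longrightarrow> D s = \<gamma> * K D s" and s: "s \<in> S"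
  shows "D s = 0"
proof -
  define C where "C = Max ((\<lambda>s. \<bar>D s\<bar>) ` S)"
  have le: "\<bar>D s\<bar> \<le> C" if "s \<in> S" for s
    unfolding C_def using finite_S that by (intro Max_ge) auto
  have "C \<in> (\<lambda>s. \<bar>D s\<bar>) ` S"
    unfolding C_def using finite_S s by (intro Max_in) auto
  then obtain s' where s': "s' \<in> S" "C = \<bar>D s'\<bar>" by auto
  have "\<bar>K D s'\<bar> \<le> C"
    using K_pow_abs_le[of D C "\<lambda>_. 1" s' 1] K_pow_const[of s' 1 1] le s' by simp
  then have "C \<le> \<gamma> * C"
    using D[OF s'(1)] \<gamma> by (simp add: s'(2) abs_mult mult_left_mono)
  then have "(1 - \<gamma>) * C \<le> 0"
    by (simp add: algebra_simps)
  then have "C \<le> 0"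
    using \<gamma> by (simp add: mult_le_0_iff)
  then show ?thesis
    using le[OF s] by simp
qed

section \<open>Trajectory laws under the shift\<close>

lemma sets_traj' [measurable_cong]: "s \<in> S \<Longrightarrow> sets (traj S P s) = sets paths"
  using kernel by (rule sets_traj)

lemma space_traj: "s \<in> S \<Longrightarrow> space (traj S P s) = (\<Pi>\<^sub>E _\<in>UNIV. S)"
  by (simp add: sets_eq_imp_space_eq[OF sets_traj'] space_PiM)

lemma traj_in_S: "s \<in> S \<Longrightarrow> \<omega> \<in> space (traj S P s) \<Longrightarrow> \<omega> t \<in> S"
  by (auto simp: space_traj)

lemma measurable_shift_traj: "s \<in> S \<Longrightarrow> shift k \<in> traj S P s \<rightarrow>\<^sub>M paths"
  by (subst measurable_cong_sets[OF sets_traj' refl]) (auto intro: measurable_shift)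

lemma measurable_traj:
  "s \<in> S \<Longrightarrow> traj S P \<in> restrict_space (measure_pmf (P s)) S \<rightarrow>\<^sub>M subprob_algebra paths"
  using sets_traj'
  by (subst measurable_cong_sets[of _ "count_space S"])
    (auto simp: sets_restrict_space space_subprob_algebra
      intro: prob_space_imp_subprob_space[OF prob_space_traj[OF kernel]])

text \<open>At \<open>T = 0\<close> the cylinder formula has an empty product, so it gives
  probability 1.\<close>

lemma AE_traj_0:
  assumes s: "s \<in> S"
  shows "AE \<omega> in traj S P s. \<omega> 0 = s"
proof -
  interpret prob_space "traj S P s" by (rule prob_space_traj[OF kernel s])
  have "emeasure (traj S P s) {\<omega> \<in> space (traj S P s). \<omega> 0 = s} = 1"
    using emeasure_traj[OF kernel s, of 0 "\<lambda>_. s"] s by simp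
  moreover have "{\<omega> \<in> space (traj S P s). \<omega> 0 = s} \<in> sets (traj S P s)"
    using sets_cylinder[OF sets_traj'[OF s], of 0 "\<lambda>_. s" "\<lambda>t. t"] s by simp
  ultimately show ?thesis
    by (auto dest: prob_eq_1 simp: emeasure_eq_measure)
qed

text \<open>The one-step Markov property. Both sides are compared on cylinders: prefixing
  \<open>s\<close> turns a cylinder of the shifted path into a longer one, and its first transition
  probability splits off as the mixing weight.\<close>

lemma traj_mixture:
  assumes s: "s \<in> S"
  shows "distr (traj S P s) paths (shift 1) = restrict_space (measure_pmf (P s)) S \<bind> traj S P"
proof (rule measure_eqI_cylinders[OF finite_S])
  interpret prob_space "traj S P s" by (rule prob_space_traj[OF kernel s])
  have sh: "shift 1 \<in> traj S P s \<rightarrow>\<^sub>M paths"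
    using s by (rule measurable_shift_traj)
  have ne: "space (restrict_space (measure_pmf (P s)) S) \<noteq> {}"
    using s by (auto simp: space_restrict_space)
  let ?Q = "restrict_space (measure_pmf (P s)) S \<bind> traj S P"
  show setsQ: "sets ?Q = sets paths"
    using ne by (intro sets_bind) (auto simp: space_restrict_space sets_traj')
  show "finite_measure (distr (traj S P s) paths (shift 1))"
    by (intro prob_space.finite_measure prob_space_distr sh)
  fix w :: "nat \<Rightarrow> 's" and T :: nat
  assume w: "\<And>t. t \<le> T \<Longrightarrow> w t \<in> S"
  let ?C = "{\<omega> \<in> space paths. \<forall>t\<le>T. \<omega> t = w t}"
  have C: "?C \<in> sets paths"
    by (rule sets_cylinder[OF refl w])
  let ?p = "\<Prod>t<T. pmf (P (w t)) (w (Suc t))"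
  have E: "emeasure (traj S P s') ?C = (if w 0 = s' then ennreal ?p else 0)" if "s' \<in> S" for s'
    using emeasure_traj[OF kernel that w] unfolding sets_eq_imp_space_eq[OF sets_traj'[OF that]] .
  \<comment> \<open>The segment \<open>w\<close> delayed by one and prefixed with \<open>s\<close>.
    The extra condition at time 0 holds almost surely, so it leaves the probability
    unchanged.\<close>
  let ?w = "\<lambda>t. case t of 0 \<Rightarrow> s | Suc u \<Rightarrow> w u"
  have "emeasure (distr (traj S P s) paths (shift 1)) ?C =
      emeasure (traj S P s) {\<omega> \<in> space (traj S P s). \<forall>t\<le>T. \<omega> (Suc t) = w t}"
  proof -
    have "shift 1 -` ?C \<inter> space (traj S P s) = {\<omega> \<in> space (traj S P s). \<forall>t\<le>T. \<omega> (Suc t) = w t}"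
      using s by (auto simp: space_traj space_PiM)
    then show ?thesis
      by (simp only: emeasure_distr[OF sh C])
  qed
  also have "\<dots> = emeasure (traj S P s) {\<omega> \<in> space (traj S P s). \<forall>t\<le>Suc T. \<omega> t = ?w t}"
  proof (rule emeasure_eq_AE)
    have all: "(\<forall>t\<le>Suc T. R t) \<longleftrightarrow> R 0 \<and> (\<forall>t\<le>T. R (Suc t))" for R
      by (metis Suc_le_mono le0 not0_implies_Suc)
    show "AE \<omega> in traj S P s. \<omega> \<in> {\<omega> \<in> space (traj S P s). \<forall>t\<le>T. \<omega> (Suc t) = w t} \<longleftrightarrow>
        \<omega> \<in> {\<omega> \<in> space (traj S P s). \<forall>t\<le>Suc T. \<omega> t = ?w t}"
      using AE_traj_0[OF s] by eventually_elim (simp add: all)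
    show "{\<omega> \<in> space (traj S P s). \<forall>t\<le>T. \<omega> (Suc t) = w t} \<in> sets (traj S P s)"
      by (rule sets_cylinder[OF sets_traj'[OF s] w])
    show "{\<omega> \<in> space (traj S P s). \<forall>t\<le>Suc T. \<omega> t = ?w t} \<in> sets (traj S P s)"
      by (rule sets_cylinder[OF sets_traj'[OF s]]) (use w s in \<open>auto split: nat.split\<close>)
  qed
  also have "\<dots> = ennreal (\<Prod>t<Suc T. pmf (P (?w t)) (?w (Suc t)))"
    using w s by (subst emeasure_traj[OF kernel s]) (auto split: nat.split)
  also have "\<dots> = ennreal (pmf (P s) (w 0)) * ennreal ?p"
    by (simp add: prod.lessThan_Suc_shift ennreal_mult prod_nonneg del: prod.lessThan_Suc)
  \<comment> \<open>Written as a sum over all first states, of which only \<open>w 0\<close>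
    contributes, to match the mixture.\<close>
  also have "\<dots> = (\<Sum>s'\<in>S. if w 0 = s' then ennreal (pmf (P s) s') * ennreal ?p else 0)"
    using w[of 0] finite_S by simp
  also have "\<dots> = (\<Sum>s'\<in>S. emeasure (traj S P s') ?C * ennreal (pmf (P s) s'))"
    by (intro sum.cong refl) (simp add: E mult.commute)
  also have "\<dots> = (\<integral>\<^sup>+s'. emeasure (traj S P s') ?C * indicator S s' \<partial>measure_pmf (P s))"
    using kernel s finite_S
    by (subst nn_integral_measure_pmf_support[OF finite_S]) (auto simp: is_kernel_def intro!: sum.cong)
  also have "\<dots> = emeasure ?Q ?C"
    using ne by (subst emeasure_bind[OF _ measurable_traj[OF s] C]) (auto simp: nn_integral_restrict_space)
  finally show "emeasure (distr (traj S P s) paths (shift 1))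
      {\<omega> \<in> space (distr (traj S P s) paths (shift 1)). \<forall>t\<le>T. \<omega> t = w t} =
      emeasure ?Q {\<omega> \<in> space ?Q. \<forall>t\<le>T. \<omega> t = w t}"
    using sets_eq_imp_space_eq[OF setsQ] by simp
qed simp

lemma nn_integral_shift:
  assumes s: "s \<in> S" and f: "f \<in> borel_measurable paths"
  shows "(\<integral>\<^sup>+\<omega>. f (shift 1 \<omega>) \<partial>traj S P s) =
    (\<Sum>s'\<in>S. ennreal (pmf (P s) s') * (\<integral>\<^sup>+\<omega>. f \<omega> \<partial>traj S P s'))"
proof -
  have sh: "shift 1 \<in> traj S P s \<rightarrow>\<^sub>M paths"
    using s by (rule measurable_shift_traj)
  have "(\<integral>\<^sup>+\<omega>. f (shift 1 \<omega>) \<partial>traj S P s) = (\<integral>\<^sup>+\<omega>. f \<omega> \<partial>distr (traj S P s) paths (shift 1))"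
    using sh f by (simp add: nn_integral_distr)
  also have "\<dots> = (\<integral>\<^sup>+s'. (\<integral>\<^sup>+\<omega>. f \<omega> \<partial>traj S P s') * indicator S s' \<partial>measure_pmf (P s))"
    unfolding traj_mixture[OF s] nn_integral_bind[OF f measurable_traj[OF s]]
    by (subst nn_integral_restrict_space) auto
  also have "\<dots> = (\<Sum>s'\<in>S. ennreal (pmf (P s) s') * (\<integral>\<^sup>+\<omega>. f \<omega> \<partial>traj S P s'))"
    using kernel s
    by (subst nn_integral_measure_pmf_support[OF finite_S])
      (auto simp: is_kernel_def mult.commute intro!: sum.cong)
  finally show ?thesis .
qed

lemma
  fixes f :: "(nat \<Rightarrow> 's) \<Rightarrow> real"
  assumes s: "s \<in> S" and f: "f \<in> borel_measurable paths"
    and int: "\<And>s'. s' \<in> S \<Longrightarrow> integrable (traj S P s') f"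
  shows integrable_shift_1: "integrable (traj S P s) (\<lambda>\<omega>. f (shift 1 \<omega>))"
    and integral_shift_1: "(\<integral>\<omega>. f (shift 1 \<omega>) \<partial>traj S P s) = K (\<lambda>s'. \<integral>\<omega>. f \<omega> \<partial>traj S P s') s"
proof -
  have sh: "shift 1 \<in> traj S P s \<rightarrow>\<^sub>M paths"
    using s by (rule measurable_shift_traj)
  note * = integral_finite_mixture[OF finite_S _ int sh f nn_integral_shift[OF s]]
  show "integrable (traj S P s) (\<lambda>\<omega>. f (shift 1 \<omega>))"
    by (rule *(1)) auto
  show "(\<integral>\<omega>. f (shift 1 \<omega>) \<partial>traj S P s) = K (\<lambda>s'. \<integral>\<omega>. f \<omega> \<partial>traj S P s') s"
    unfolding K_def by (rule *(2)) auto
qed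

text \<open>The shift by \<open>Suc n\<close> is the shift by one followed by the shift by
  \<open>n\<close>. Peeling off the first step lets the induction hypothesis be used at every
  successor state.\<close>

lemma
  fixes f :: "(nat \<Rightarrow> 's) \<Rightarrow> real"
  assumes s: "s \<in> S" and f: "f \<in> borel_measurable paths"
    and int: "\<And>s'. s' \<in> S \<Longrightarrow> integrable (traj S P s') f"
  shows integrable_shift: "integrable (traj S P s) (\<lambda>\<omega>. f (shift n \<omega>))"
    and integral_shift: "(\<integral>\<omega>. f (shift n \<omega>) \<partial>traj S P s) = (K ^^ n) (\<lambda>s'. \<integral>\<omega>. f \<omega> \<partial>traj S P s') s"
proof -
  have "integrable (traj S P s) (\<lambda>\<omega>. f (shift n \<omega>)) \<and>
      (\<integral>\<omega>. f (shift n \<omega>) \<partial>traj S P s) = (K ^^ n) (\<lambda>s'. \<integral>\<omega>. f \<omega> \<partial>traj S P s') s"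
    using s
  proof (induction n arbitrary: s)
    case 0
    then show ?case using int by simp
  next
    case (Suc n)
    have m: "(\<lambda>\<omega>. f (shift n \<omega>)) \<in> borel_measurable paths"
      using measurable_shift f by (rule measurable_compose)
    have "integrable (traj S P s) (\<lambda>\<omega>. f (shift n (shift 1 \<omega>)))"
      using Suc by (intro integrable_shift_1 m) auto
    moreover have "(\<integral>\<omega>. f (shift n (shift 1 \<omega>)) \<partial>traj S P s) = K (\<lambda>s'. \<integral>\<omega>. f (shift n \<omega>) \<partial>traj S P s') s"
      using Suc by (intro integral_shift_1 m) auto
    moreover have "\<dots> = K ((K ^^ n) (\<lambda>s'. \<integral>\<omega>. f \<omega> \<partial>traj S P s')) s"
      using Suc by (intro K_cong) auto
    ultimately show ?case by simp
  qed
  then show "integrable (traj S P s) (\<lambda>\<omega>. f (shift n \<omega>))"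
    and "(\<integral>\<omega>. f (shift n \<omega>) \<partial>traj S P s) = (K ^^ n) (\<lambda>s'. \<integral>\<omega>. f \<omega> \<partial>traj S P s') s" by auto
qed

end

section \<open>The Bellman equation\<close>

locale finite_mrp =
  fixes S :: "'s set" and M :: "'s mrp"
  assumes finite_S: "finite S" and mrp: "M \<in> mrps S"

sublocale finite_mrp \<subseteq> finite_chain S "trans M"
  using finite_S mrp by unfold_locales (auto simp: mrps_def)

context finite_mrp
begin

section \<open>Measurability, and existence of the value in the discounted case\<close>

lemma K_mean_rew: "K (mean_rew M s) s = avg_rew S M s"
  by (simp add: K_def avg_rew_def)

lemma measurable_disc_rew: "(\<lambda>\<omega>. disc_rew \<gamma> M \<omega> t) \<in> borel_measurable paths"
proof -
  have "(\<lambda>\<omega>. (\<omega> t, \<omega> (Suc t))) \<in> paths \<rightarrow>\<^sub>M count_space S \<Otimes>\<^sub>M count_space S"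
    by measurable
  \<comment> \<open>As \<open>S\<close> is finite, the product of the discrete sigma-algebras is
    discrete, so every function of the pair is measurable.\<close>
  then have "(\<lambda>\<omega>. (\<omega> t, \<omega> (Suc t))) \<in> paths \<rightarrow>\<^sub>M count_space (S \<times> S)"
    using finite_S by (simp add: pair_measure_countable countable_finite)
  then have "(\<lambda>\<omega>. (\<lambda>(x, y). mean_rew M x y) (\<omega> t, \<omega> (Suc t))) \<in> borel_measurable paths"
    by (rule measurable_compose) simp
  then show ?thesis
    by (simp add: disc_rew_def)
qed

lemma measurable_total: "(\<lambda>\<omega>. \<Sum>t. disc_rew \<gamma> M \<omega> t) \<in> borel_measurable paths"
  using measurable_disc_rew by (rule borel_measurable_suminf)

lemma borel_measurable_traj:
  "s \<in> S \<Longrightarrow> f \<in> borel_measurable paths \<Longrightarrow> f \<in> borel_measurable (traj S (trans M) s)"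
  by (subst measurable_cong_sets[OF sets_traj' refl])

lemma integrable_bounded_traj:
  fixes f :: "(nat \<Rightarrow> 's) \<Rightarrow> real"
  assumes "s \<in> S" "f \<in> borel_measurable paths"
    and "\<And>\<omega>. \<omega> \<in> space (traj S (trans M) s) \<Longrightarrow> \<bar>f \<omega>\<bar> \<le> B"
  shows "integrable (traj S (trans M) s) f"
proof -
  interpret prob_space "traj S (trans M) s" by (rule prob_space_traj[OF kernel assms(1)])
  show ?thesis
    using assms by (intro integrable_const_bound[where B=B] borel_measurable_traj) auto
qed

lemma mean_rew_bounded: "\<exists>B. \<forall>s\<in>S. \<forall>s'\<in>S. \<bar>mean_rew M s s'\<bar> \<le> B"
proof (intro exI ballI)
  fix s s' assume "s \<in> S" "s' \<in> S"
  then have "\<bar>mean_rew M s s'\<bar> \<le> (\<Sum>y\<in>S. \<bar>mean_rew M s y\<bar>)"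
    using finite_S by (intro member_le_sum[of s' S "\<lambda>y. \<bar>mean_rew M s y\<bar>"]) auto
  also have "\<dots> \<le> (\<Sum>x\<in>S. \<Sum>y\<in>S. \<bar>mean_rew M x y\<bar>)"
    using \<open>s \<in> S\<close> finite_S
    by (intro member_le_sum[of s S "\<lambda>x. \<Sum>y\<in>S. \<bar>mean_rew M x y\<bar>"]) (auto simp: sum_nonneg)
  finally show "\<bar>mean_rew M s s'\<bar> \<le> (\<Sum>x\<in>S. \<Sum>y\<in>S. \<bar>mean_rew M x y\<bar>)" .
qed

text \<open>Mean rewards are bounded on the finite set \<open>S\<close>, so a geometric series
  dominates the reward series on every path; the total reward is then bounded as well.\<close>

lemma value_defined_discounted:
  assumes "0 \<le> \<gamma>" "\<gamma> < 1"
  shows "value_defined \<gamma> S M"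
proof -
  obtain B where B: "\<And>s s'. s \<in> S \<Longrightarrow> s' \<in> S \<Longrightarrow> \<bar>mean_rew M s s'\<bar> \<le> B"
    using mean_rew_bounded by blast
  have bound: "norm (disc_rew \<gamma> M \<omega> t) \<le> B * \<gamma> ^ t"
    if "s \<in> S" "\<omega> \<in> space (traj S (trans M) s)" for s \<omega> t
    using mult_right_mono[OF B[of "\<omega> t" "\<omega> (Suc t)"], of "\<gamma> ^ t"] traj_in_S[OF that] assms
    by (simp add: disc_rew_def abs_mult mult.commute)
  have geo: "summable (\<lambda>t. B * \<gamma> ^ t)"
    using assms by (intro summable_mult summable_geometric) simp
  show ?thesis
    unfolding value_defined_def
  proof (intro ballI conjI)
    fix s assume s: "s \<in> S"
    show "AE \<omega> in traj S (trans M) s. summable (disc_rew \<gamma> M \<omega>)"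
      using bound[OF s] by (intro AE_I2 summable_comparison_test'[OF geo, of 0]) blast
    show "integrable (traj S (trans M) s) (\<lambda>\<omega>. \<Sum>t. disc_rew \<gamma> M \<omega> t)"
    proof (rule integrable_bounded_traj[OF s measurable_total])
      fix \<omega> assume "\<omega> \<in> space (traj S (trans M) s)"
      then show "\<bar>\<Sum>t. disc_rew \<gamma> M \<omega> t\<bar> \<le> (\<Sum>t. B * \<gamma> ^ t)"
        using norm_suminf_le[OF bound[OF s] geo] by simp
    qed
  qed
qed

section \<open>Bellman equation, iteration and limit, given a defined value\<close>

context
  fixes \<gamma> :: real
  assumes defd: "value_defined \<gamma> S M"
begin

lemma integrable_total: "s \<in> S \<Longrightarrow> integrable (traj S (trans M) s) (\<lambda>\<omega>. \<Sum>t. disc_rew \<gamma> M \<omega> t)"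
  using defd by (simp add: value_defined_def)

lemma AE_summable: "s \<in> S \<Longrightarrow> AE \<omega> in traj S (trans M) s. summable (disc_rew \<gamma> M \<omega>)"
  using defd by (simp add: value_defined_def)

text \<open>The total reward is the first reward plus \<open>\<gamma>\<close> times the total reward
  of the shifted path; under the expectation the shift becomes \<open>K\<close>.\<close>

lemma value_fun_bellman:
  assumes s: "s \<in> S"
  shows "value_fun \<gamma> S M s = avg_rew S M s + \<gamma> * K (value_fun \<gamma> S M) s"
proof -
  \<comment> \<open>\<open>f\<close> is read on the path shifted by one, whose coordinate 0 is the
    first successor. The starting state \<open>s\<close> is kept as a parameter because the shift
    forgets it.\<close>
  define f where "f \<omega> = mean_rew M s (\<omega> 0) + \<gamma> * (\<Sum>t. disc_rew \<gamma> M \<omega> t)" for \<omega>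
  have m0: "(\<lambda>\<omega>. mean_rew M s (\<omega> 0)) \<in> borel_measurable paths"
    by (rule measurable_compose[where N="count_space S"]) auto
  then have f: "f \<in> borel_measurable paths"
    unfolding f_def using measurable_total by measurable
  obtain B where B: "\<And>s s'. s \<in> S \<Longrightarrow> s' \<in> S \<Longrightarrow> \<bar>mean_rew M s s'\<bar> \<le> B"
    using mean_rew_bounded by blast
  have int0: "integrable (traj S (trans M) s') (\<lambda>\<omega>. mean_rew M s (\<omega> 0))" if "s' \<in> S" for s'
    using that B s traj_in_S by (intro integrable_bounded_traj[where B=B] m0) auto
  have intf: "integrable (traj S (trans M) s') f" if "s' \<in> S" for s'
    unfolding f_def using that int0 integrable_total by simp
  have Ef: "(\<integral>\<omega>. f \<omega> \<partial>traj S (trans M) s') = mean_rew M s s' + \<gamma> * value_fun \<gamma> S M s'" if s': "s' \<in> S" for s'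
  proof -
    interpret prob_space "traj S (trans M) s'" by (rule prob_space_traj[OF kernel s'])
    have "(\<integral>\<omega>. mean_rew M s (\<omega> 0) \<partial>traj S (trans M) s') = (\<integral>\<omega>. mean_rew M s s' \<partial>traj S (trans M) s')"
      using AE_traj_0[OF s'] s' m0 by (intro integral_cong_AE) (auto intro: borel_measurable_traj)
    then show ?thesis
      unfolding f_def value_fun_def using int0[OF s'] integrable_total[OF s'] by (simp add: prob_space)
  qed
  have "value_fun \<gamma> S M s = (\<integral>\<omega>. f (shift 1 \<omega>) \<partial>traj S (trans M) s)"
    unfolding value_fun_def
  proof (rule integral_cong_AE)
    show "AE \<omega> in traj S (trans M) s. (\<Sum>t. disc_rew \<gamma> M \<omega> t) = f (shift 1 \<omega>)"
      using AE_summable[OF s] AE_traj_0[OF s]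
    proof eventually_elim
      case (elim \<omega>)
      have eq: "disc_rew \<gamma> M \<omega> (Suc t) = \<gamma> * disc_rew \<gamma> M (shift 1 \<omega>) t" for t
        by (simp add: disc_rew_def)
      have "summable (\<lambda>t. \<gamma> * disc_rew \<gamma> M (shift 1 \<omega>) t)"
        using elim(1) summable_Suc_iff[of "disc_rew \<gamma> M \<omega>"] by (simp add: eq)
      \<comment> \<open>For \<open>\<gamma> = 0\<close> summability of the shifted series cannot be
        recovered from the scaled one, but both sides are 0.\<close>
      then have "(\<Sum>t. \<gamma> * disc_rew \<gamma> M (shift 1 \<omega>) t) = \<gamma> * (\<Sum>t. disc_rew \<gamma> M (shift 1 \<omega>) t)"
        by (cases "\<gamma> = 0") (auto simp: suminf_mult summable_cmult_iff)
      then show ?case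
        using suminf_split_head[OF elim(1)] elim(2) by (simp add: eq f_def) (simp add: disc_rew_def)
    qed
    show "(\<lambda>\<omega>. f (shift 1 \<omega>)) \<in> borel_measurable (traj S (trans M) s)"
      by (intro borel_measurable_traj[OF s] measurable_compose[OF measurable_shift f])
  qed (intro borel_measurable_traj s measurable_total)
  also have "\<dots> = K (\<lambda>s'. \<integral>\<omega>. f \<omega> \<partial>traj S (trans M) s') s"
    by (rule integral_shift_1[OF s f intf])
  also have "\<dots> = K (\<lambda>s'. mean_rew M s s' + \<gamma> * value_fun \<gamma> S M s') s"
    by (intro K_cong Ef)
  also have "\<dots> = avg_rew S M s + \<gamma> * K (value_fun \<gamma> S M) s"
    unfolding K_add_scaled K_mean_rew ..
  finally show ?thesis .
qed

text \<open>Each round substitutes the Bellman equation into the remainder. That equation is known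
  only on \<open>S\<close>, so the substitution under the power of \<open>K\<close> goes through
  \<open>K_pow_cong\<close>.\<close>

lemma value_fun_iterate:
  assumes s: "s \<in> S"
  shows "value_fun \<gamma> S M s = (\<Sum>t<T. \<gamma> ^ t * (K ^^ t) (avg_rew S M) s) + \<gamma> ^ T * (K ^^ T) (value_fun \<gamma> S M) s"
proof (induction T)
  case (Suc T)
  have "(K ^^ T) (value_fun \<gamma> S M) s = (K ^^ T) (\<lambda>s. avg_rew S M s + \<gamma> * K (value_fun \<gamma> S M) s) s"
    using value_fun_bellman s by (intro K_pow_cong)
  also have "\<dots> = (K ^^ T) (avg_rew S M) s + \<gamma> * (K ^^ Suc T) (value_fun \<gamma> S M) s"
    by (simp add: K_pow_add_scaled funpow_swap1)
  finally show ?case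
    using Suc.IH by (simp add: algebra_simps)
qed simp

text \<open>
  For \<open>\<gamma> = 1\<close> the weight \<open>h s = E\<^sub>s [min 1 \<bar>X\<bar>]\<close>, with \<open>X\<close> the total reward, vanishes only where
  \<open>X = 0\<close> almost surely, so the value function is bounded by a multiple of \<open>h\<close>; and \<open>K\<^sup>T h\<close>
  is the expectation of \<open>min 1\<close> of the tail of a convergent series.
\<close>
lemma K_pow_value_fun_tendsto:
  assumes \<gamma>: "\<gamma> = 1" and s: "s \<in> S"
  shows "(\<lambda>T. (K ^^ T) (value_fun \<gamma> S M) s) \<longlonglongrightarrow> 0"
proof -
  define X where "X \<omega> = (\<Sum>t. disc_rew \<gamma> M \<omega> t)" for \<omega>
  define h where "h s = (\<integral>\<omega>. min 1 \<bar>X \<omega>\<bar> \<partial>traj S (trans M) s)" for s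
  have mX: "X \<in> borel_measurable paths"
    unfolding X_def by (rule measurable_total)
  then have mm: "(\<lambda>\<omega>. min 1 \<bar>X \<omega>\<bar>) \<in> borel_measurable paths"
    by measurable
  have intm: "integrable (traj S (trans M) s) (\<lambda>\<omega>. min 1 \<bar>X \<omega>\<bar>)" if "s \<in> S" for s
    using that mm by (intro integrable_bounded_traj[where B=1]) auto
  have h0: "0 \<le> h s" for s
    by (auto simp: h_def)
  have hV: "value_fun \<gamma> S M s = 0" if "h s = 0" and s: "s \<in> S" for s
  proof -
    have "AE \<omega> in traj S (trans M) s. min 1 \<bar>X \<omega>\<bar> = 0"
      using that(1) integral_nonneg_eq_0_iff_AE[OF intm[OF s]] by (simp add: h_def)
    then have "AE \<omega> in traj S (trans M) s. X \<omega> = 0"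
      by eventually_elim (auto simp: min_def split: if_splits)
    then have "(\<integral>\<omega>. X \<omega> \<partial>traj S (trans M) s) = (\<integral>\<omega>. 0 \<partial>traj S (trans M) s)"
      using mX s by (intro integral_cong_AE) (auto intro: borel_measurable_traj)
    then show ?thesis
      by (simp add: value_fun_def X_def)
  qed
  \<comment> \<open>States with \<open>h s = 0\<close> contribute 0 to this sum because division by
    0 yields 0; for them the bound below holds since the value vanishes too.\<close>
  define C where "C = (\<Sum>s\<in>S. \<bar>value_fun \<gamma> S M s\<bar> / h s)"
  have VC: "\<bar>value_fun \<gamma> S M s\<bar> \<le> C * h s" if s: "s \<in> S" for s
  proof (cases "h s = 0")
    case False
    have "\<bar>value_fun \<gamma> S M s\<bar> / h s \<le> C"
      unfolding C_def using finite_S s h0 by (intro member_le_sum[of s S "\<lambda>s. \<bar>value_fun \<gamma> S M s\<bar> / h s"]) auto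
    then show ?thesis
      using False h0[of s] by (simp add: divide_le_eq)
  qed (simp add: hV s)
  have "(\<lambda>T. (K ^^ T) h s) \<longlonglongrightarrow> 0"
  proof -
    interpret prob_space "traj S (trans M) s" by (rule prob_space_traj[OF kernel s])
    have "(\<lambda>T. \<integral>\<omega>. min 1 \<bar>X (shift T \<omega>)\<bar> \<partial>traj S (trans M) s) \<longlonglongrightarrow> (\<integral>\<omega>. 0 \<partial>traj S (trans M) s)"
    proof (rule integral_dominated_convergence[where w="\<lambda>_. 1"])
      show "AE \<omega> in traj S (trans M) s. (\<lambda>T. min 1 \<bar>X (shift T \<omega>)\<bar>) \<longlonglongrightarrow> 0"
        using AE_summable[OF s]
      proof eventually_elim
        case (elim \<omega>)
        \<comment> \<open>For \<open>\<gamma> = 1\<close> the shifted path carries no extra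
          discount, so its total reward is exactly a tail of the series.\<close>
        have "X (shift T \<omega>) = X \<omega> - (\<Sum>t<T. disc_rew \<gamma> M \<omega> t)" for T
          using suminf_minus_initial_segment[OF elim, of T] by (simp add: X_def disc_rew_def \<gamma>)
        moreover have "(\<lambda>T. X \<omega> - (\<Sum>t<T. disc_rew \<gamma> M \<omega> t)) \<longlonglongrightarrow> X \<omega> - X \<omega>"
          unfolding X_def by (intro tendsto_intros summable_LIMSEQ elim)
        ultimately have "(\<lambda>T. X (shift T \<omega>)) \<longlonglongrightarrow> 0" by simp
        then have "(\<lambda>T. min 1 \<bar>X (shift T \<omega>)\<bar>) \<longlonglongrightarrow> min 1 \<bar>0\<bar>"
          by (intro tendsto_intros)
        then show ?case by simp
      qed
      show "(\<lambda>\<omega>. min 1 \<bar>X (shift T \<omega>)\<bar>) \<in> borel_measurable (traj S (trans M) s)" for T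
        by (intro borel_measurable_traj[OF s] measurable_compose[OF measurable_shift mm])
    qed auto
    then show ?thesis
      using integral_shift[OF s mm intm] by (simp add: h_def[abs_def])
  qed
  then have "(\<lambda>T. C * (K ^^ T) h s) \<longlonglongrightarrow> 0"
    by (rule tendsto_mult_right_zero)
  then show ?thesis
    by (rule Lim_null_comparison[rotated]) (use K_pow_abs_le[OF VC s] in auto)
qed

text \<open>The value thus depends on the process only through \<open>K\<close> and
  \<open>avg_rew\<close>. For \<open>\<gamma> < 1\<close> the remainder of the iteration decays
  geometrically, as the powers of \<open>K\<close> keep it bounded on \<open>S\<close>; for
  \<open>\<gamma> = 1\<close> the preceding lemma applies.\<close>

lemma value_fun_limit:
  assumes \<gamma>: "0 \<le> \<gamma>" "\<gamma> \<le> 1" and s: "s \<in> S"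
  shows "(\<lambda>T. \<Sum>t<T. \<gamma> ^ t * (K ^^ t) (avg_rew S M) s) \<longlonglongrightarrow> value_fun \<gamma> S M s"
proof -
  have "(\<lambda>T. \<gamma> ^ T * (K ^^ T) (value_fun \<gamma> S M) s) \<longlonglongrightarrow> 0"
  proof (cases "\<gamma> = 1")
    case True
    then show ?thesis using K_pow_value_fun_tendsto[OF True s] by simp
  next
    case False
    define C where "C = (\<Sum>s\<in>S. \<bar>value_fun \<gamma> S M s\<bar>)"
    have "\<bar>value_fun \<gamma> S M s'\<bar> \<le> C * 1" if "s' \<in> S" for s'
      unfolding C_def using finite_S that member_le_sum[of s' S "\<lambda>s. \<bar>value_fun \<gamma> S M s\<bar>"] by simp
    then have "\<bar>(K ^^ T) (value_fun \<gamma> S M) s\<bar> \<le> C" for T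
      using K_pow_abs_le[of _ C "\<lambda>_. 1" s T] s by (simp add: K_pow_const)
    then have le: "norm (\<gamma> ^ T * (K ^^ T) (value_fun \<gamma> S M) s) \<le> \<gamma> ^ T * C" for T
      using \<gamma> by (simp add: abs_mult mult_left_mono)
    have "(\<lambda>T. \<gamma> ^ T * C) \<longlonglongrightarrow> 0"
      using \<gamma> False by (intro tendsto_mult_left_zero LIMSEQ_power_zero) simp
    then show ?thesis
      by (rule Lim_null_comparison[rotated]) (use le in auto)
  qed
  then have "(\<lambda>T. value_fun \<gamma> S M s - \<gamma> ^ T * (K ^^ T) (value_fun \<gamma> S M) s) \<longlonglongrightarrow> value_fun \<gamma> S M s - 0"
    by (intro tendsto_intros)
  moreover have "value_fun \<gamma> S M s - \<gamma> ^ T * (K ^^ T) (value_fun \<gamma> S M) s =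
      (\<Sum>t<T. \<gamma> ^ t * (K ^^ t) (avg_rew S M) s)" for T
    using value_fun_iterate[OF s, of T] by simp
  ultimately show ?thesis by simp
qed

end

end

section \<open>Separable functions and decoupled processes\<close>

lemma separableI:
  "(\<And>s. s \<in> prod_states d A \<Longrightarrow> V s = (\<Sum>i<d. W i (s i))) \<Longrightarrow> V \<in> separable d A"
  unfolding separable_def mem_Collect_eq by (intro exI[of _ W] ballI)

lemma separableE:
  assumes "V \<in> separable d A"
  obtains W where "\<forall>s\<in>prod_states d A. V s = (\<Sum>i<d. W i (s i))"
  using assms unfolding separable_def mem_Collect_eq by (elim exE)

lemma separable_lincomb:
  assumes "\<And>t. t < T \<Longrightarrow> f t \<in> separable d A"
  shows "(\<lambda>s. \<Sum>t<T. c t * f t s) \<in> separable d A"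
proof -
  have "\<forall>t. \<exists>W. t < T \<longrightarrow> (\<forall>s\<in>prod_states d A. f t s = (\<Sum>i<d. W i (s i)))"
    using assms by (auto simp: separable_def)
  then obtain W where W: "\<And>t s. t < T \<Longrightarrow> s \<in> prod_states d A \<Longrightarrow> f t s = (\<Sum>i<d. W t i (s i))"
    by metis
  have "(\<Sum>t<T. c t * f t s) = (\<Sum>i<d. \<Sum>t<T. c t * W t i (s i))" if "s \<in> prod_states d A" for s
    using W that by (subst sum.swap) (simp add: sum_distrib_left)
  then show ?thesis
    by (intro separableI[where W="\<lambda>i x. \<Sum>t<T. c t * W t i x"]) simp
qed

text \<open>
  Separability amounts to the identities \<open>V s - V a = (\<Sum>i<d. V (a(i := s i)) - V a)\<close>, which are
  closed conditions.
\<close>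
lemma separable_limit:
  fixes A :: "nat \<Rightarrow> 'a set"
  assumes U: "\<And>n. U n \<in> separable d A"
    and lim: "\<And>s. s \<in> prod_states d A \<Longrightarrow> (\<lambda>n. U n s) \<longlonglongrightarrow> V s"
  shows "V \<in> separable d A"
\<comment> \<open>For \<open>d = 0\<close> the empty sum forces separable functions to vanish, and
  an empty state space makes the claim vacuous. Otherwise a base point and division by
  \<open>d\<close> are available.\<close>
proof (cases "d = 0 \<or> prod_states d A = {}")
  case True
  have "V s = 0" if s: "s \<in> prod_states d A" for s
  proof -
    have "d = 0" using True s by blast
    then have "U n s = 0" for n
      using U[of n] s by (auto simp: separable_def)
    then show ?thesis
      using lim[OF s] by (simp add: LIMSEQ_const_iff)
  qed
  moreover have "(\<Sum>i<d. (0::real)) = 0" by simp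
  ultimately show ?thesis
    by (intro separableI[where W="\<lambda>_ _. 0"]) simp
next
  case False
  then obtain a where a: "a \<in> prod_states d A" by auto
  have upd: "a(i := s i) \<in> prod_states d A" if "s \<in> prod_states d A" "i < d" for s i
    using a that by (auto simp: PiE_iff extensional_def)
  have diff: "V s - V a = (\<Sum>i<d. V (a(i := s i)) - V a)" if s: "s \<in> prod_states d A" for s
  proof -
    have "U n s - U n a = (\<Sum>i<d. U n (a(i := s i)) - U n a)" for n
    proof -
      obtain W where W: "\<forall>s\<in>prod_states d A. U n s = (\<Sum>i<d. W i (s i))"
        using U[of n] by (rule separableE)
      \<comment> \<open>Changing one coordinate affects only its own summand; all others
        cancel.\<close>
      have "U n (a(i := s i)) - U n a = W i (s i) - W i (a i)" if "i < d" for i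
        using that bspec[OF W a] bspec[OF W upd[OF s that]]
        by (simp add: sum.remove[of "{..<d}" i] cong: sum.cong_simp)
      then show ?thesis
        using bspec[OF W s] bspec[OF W a] by (simp add: sum_subtractf)
    qed
    moreover have "(\<lambda>n. U n s - U n a) \<longlonglongrightarrow> V s - V a"
      by (intro tendsto_intros lim s a)
    moreover have "(\<lambda>n. \<Sum>i<d. U n (a(i := s i)) - U n a) \<longlonglongrightarrow> (\<Sum>i<d. V (a(i := s i)) - V a)"
      by (intro tendsto_intros lim upd s a) simp
    ultimately show ?thesis
      using LIMSEQ_unique by simp
  qed
  \<comment> \<open>The constant \<open>V a\<close> is shared equally among the \<open>d\<close>
    coordinates.\<close>
  have "V s = (\<Sum>i<d. V (a(i := s i)) - V a + V a / d)" if "s \<in> prod_states d A" for s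
    using diff[OF that] False by (simp add: sum.distrib)
  then show ?thesis
    by (intro separableI[where W="\<lambda>i x. V (a(i := x)) - V a + V a / d"]) simp
qed

text \<open>The expectation of a sum of coordinate functions under product weights: each
  \<open>j\<close> is treated separately, and the weights of the other coordinates sum to 1.\<close>

lemma sum_PiE_prod_mult_sum:
  fixes p g :: "'i \<Rightarrow> 'a \<Rightarrow> real"
  assumes I: "finite I" and A: "\<And>i. i \<in> I \<Longrightarrow> finite (A i)" and p: "\<And>i. i \<in> I \<Longrightarrow> (\<Sum>x\<in>A i. p i x) = 1"
  shows "(\<Sum>s\<in>Pi\<^sub>E I A. (\<Prod>i\<in>I. p i (s i)) * (\<Sum>j\<in>I. g j (s j))) = (\<Sum>j\<in>I. \<Sum>x\<in>A j. p j x * g j x)"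
proof -
  have "(\<Sum>s\<in>Pi\<^sub>E I A. (\<Prod>i\<in>I. p i (s i)) * g j (s j)) = (\<Sum>x\<in>A j. p j x * g j x)" if j: "j \<in> I" for j
  proof -
    \<comment> \<open>With \<open>g j\<close> written as a product whose factors off
      \<open>j\<close> are 1, the sum over the product set becomes a product of one-coordinate
      sums.\<close>
    have "(\<Prod>i\<in>I. p i (s i)) * g j (s j) = (\<Prod>i\<in>I. p i (s i) * (if i = j then g j (s i) else 1))" for s
      using I j by (simp add: prod.distrib)
    then have "(\<Sum>s\<in>Pi\<^sub>E I A. (\<Prod>i\<in>I. p i (s i)) * g j (s j)) =
        (\<Prod>i\<in>I. \<Sum>x\<in>A i. p i x * (if i = j then g j x else 1))"
      using I A by (simp add: prod_sum_PiE)
    also have "\<dots> = (\<Prod>i\<in>I. if i = j then \<Sum>x\<in>A j. p j x * g j x else 1)"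
      using p by (intro prod.cong) auto
    finally show ?thesis
      using I j by simp
  qed
  then show ?thesis
    by (simp add: sum_distrib_left sum.swap[of _ _ "Pi\<^sub>E I A"])
qed

section \<open>Value functions of decoupled processes\<close>

lemma decoupledE:
  assumes "M \<in> decoupled d A"
  obtains N where "\<forall>i<d. N i \<in> mrps (A i)"
    and "\<forall>s\<in>prod_states d A. \<forall>s'\<in>prod_states d A.
      pmf (trans M s) s' = (\<Prod>i<d. pmf (trans (N i) (s i)) (s' i))"
    and "\<forall>s\<in>prod_states d A. \<forall>s'\<in>prod_states d A.
      mean_rew M s s' = (\<Sum>i<d. mean_rew (N i) (s i) (s' i))"
proof -
  from assms obtain N where N: "\<forall>i<d. N i \<in> mrps (A i)"
    "\<forall>s\<in>prod_states d A. \<forall>s'\<in>prod_states d A.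
       pmf (trans M s) s' = (\<Prod>i<d. pmf (trans (N i) (s i)) (s' i)) \<and>
       mean_rew M s s' = (\<Sum>i<d. mean_rew (N i) (s i) (s' i))"
    unfolding decoupled_def mem_Collect_eq by (elim conjE exE)
  show thesis
    using N by (intro that[of N]) simp_all
qed

lemma value_fun_decoupled:
  fixes A :: "nat \<Rightarrow> 'a set"
  assumes \<gamma>: "0 \<le> \<gamma>" "\<gamma> \<le> 1" and A: "\<And>i. i < d \<Longrightarrow> finite (A i)"
    and M: "M \<in> decoupled d A" and defd: "value_defined \<gamma> (prod_states d A) M"
  shows "value_fun \<gamma> (prod_states d A) M \<in> separable d A"
proof -
  let ?S = "prod_states d A"
  from M obtain N where N: "\<forall>i<d. N i \<in> mrps (A i)"
    and P: "\<forall>s\<in>?S. \<forall>s'\<in>?S. pmf (trans M s) s' = (\<Prod>i<d. pmf (trans (N i) (s i)) (s' i))"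
    and R: "\<forall>s\<in>?S. \<forall>s'\<in>?S. mean_rew M s s' = (\<Sum>i<d. mean_rew (N i) (s i) (s' i))"
    by (rule decoupledE)
  have mrp: "M \<in> mrps ?S"
    using M by (simp add: decoupled_def)
  interpret finite_mrp ?S M
    using A mrp by unfold_locales (auto intro: finite_PiE)
  \<comment> \<open>This serves twice. With \<open>f = mean_rew M s\<close> the functions
    \<open>g i\<close> depend on \<open>s\<close>, but only through \<open>s i\<close>, so the
    average rewards are separable; with \<open>f\<close> separable it shows that \<open>K f\<close>
    is separable.\<close>
  have step: "K f s = (\<Sum>i<d. \<Sum>x\<in>A i. pmf (trans (N i) (s i)) x * g i x)"
    if s: "s \<in> ?S" and f: "\<And>s'. s' \<in> ?S \<Longrightarrow> f s' = (\<Sum>i<d. g i (s' i))" for f g s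
  proof -
    have "(\<Sum>x\<in>A i. pmf (trans (N i) (s i)) x) = 1" if "i < d" for i
      using N A that s by (intro sum_pmf_eq_1) (auto simp: mrps_def is_kernel_def PiE_iff)
    then show ?thesis
      using A P s f sum_PiE_prod_mult_sum[of "{..<d}" A "\<lambda>i. pmf (trans (N i) (s i))" g]
      by (simp add: K_def)
  qed
  have r: "avg_rew ?S M \<in> separable d A"
  proof -
    have "avg_rew ?S M s = (\<Sum>i<d. \<Sum>x\<in>A i. pmf (trans (N i) (s i)) x * mean_rew (N i) (s i) x)"
      if "s \<in> ?S" for s
      unfolding K_mean_rew[symmetric] using that R by (intro step) auto
    then show ?thesis
      by (intro separableI[where W="\<lambda>i y. \<Sum>x\<in>A i. pmf (trans (N i) y) x * mean_rew (N i) y x"]) simp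
  qed
  have K: "K f \<in> separable d A" if "f \<in> separable d A" for f
  proof -
    from that obtain W where W: "\<forall>s\<in>?S. f s = (\<Sum>i<d. W i (s i))"
      by (rule separableE)
    have "K f s = (\<Sum>i<d. \<Sum>x\<in>A i. pmf (trans (N i) (s i)) x * W i x)" if "s \<in> ?S" for s
      using that W by (intro step) auto
    then show ?thesis
      by (intro separableI[where W="\<lambda>i y. \<Sum>x\<in>A i. pmf (trans (N i) y) x * W i x"]) simp
  qed
  have "(K ^^ t) (avg_rew ?S M) \<in> separable d A" for t
    by (induction t) (simp_all add: r K)
  then have "(\<lambda>s. \<Sum>t<T. \<gamma> ^ t * (K ^^ t) (avg_rew ?S M) s) \<in> separable d A" for T
    by (rule separable_lincomb)
  then show ?thesis
    using value_fun_limit[OF defd \<gamma>] by (rule separable_limit)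
qed

section \<open>Witness processes and a kernel that is not a product\<close>

definition det_mrp :: "('s \<Rightarrow> 's pmf) \<Rightarrow> ('s \<Rightarrow> real) \<Rightarrow> 's mrp" where
  "det_mrp P r = \<lparr>trans = P, rew = (\<lambda>s _. return borel (r s))\<rparr>"

lemma trans_det_mrp [simp]: "trans (det_mrp P r) = P"
  by (simp add: det_mrp_def)

lemma mean_rew_det_mrp [simp]: "mean_rew (det_mrp P r) s s' = r s"
  by (simp add: mean_rew_def det_mrp_def integral_return)

lemma det_mrp_in_mrps: "is_kernel S P \<Longrightarrow> det_mrp P r \<in> mrps S"
  by (auto simp: mrps_def det_mrp_def intro!: prob_space_return integrableI_bounded simp: nn_integral_return)

text \<open>The reward does not depend on the successor, so averaging it over a row of total mass 1
  returns \<open>r\<close>. Hence every kernel and every vector of average rewards are realised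
  together.\<close>

lemma det_mrp_in_mrps_with:
  assumes "finite S" "is_kernel S P"
  shows "det_mrp P r \<in> mrps_with S P r"
proof -
  interpret finite_chain S P by unfold_locales fact+
  show ?thesis
    using det_mrp_in_mrps[OF assms(2)] sum_kernel
    by (auto simp: mrps_with_def avg_rew_def simp flip: sum_distrib_right)
qed

lemma
  shows value_defined_zero_rewards: "value_defined \<gamma> S (det_mrp P (\<lambda>_. 0))"
    and value_fun_zero_rewards: "value_fun \<gamma> S (det_mrp P (\<lambda>_. 0)) s = 0"
  by (simp_all add: value_defined_def value_fun_def disc_rew_def[abs_def])

lemma separable_zero: "(\<And>s. s \<in> prod_states d A \<Longrightarrow> V s = 0) \<Longrightarrow> V \<in> separable d A"
  by (intro separableI[where W="\<lambda>_ _. 0"]) simp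

text \<open>A product law that charges \<open>a\<close> and \<open>b\<close> also charges every
  point that mixes their coordinates. The uniform law on \<open>{a, b}\<close>, used from every
  state, misses such a mixed point \<open>c\<close>.\<close>

lemma coupled_kernel_exists:
  fixes A :: "nat \<Rightarrow> 'a set"
  assumes d: "2 \<le> d" and A: "\<And>i. i < d \<Longrightarrow> 2 \<le> card (A i)"
  obtains Q where "is_kernel (prod_states d A) (\<lambda>_. Q)"
    "\<And>M. trans M = (\<lambda>_. Q) \<Longrightarrow> M \<notin> decoupled d A"
proof -
  have "\<exists>x y. x \<in> A i \<and> y \<in> A i \<and> x \<noteq> y" if "i < d" for i
    using A[OF that] by (auto simp: numeral_2_eq_2 card_le_Suc_iff)
  then obtain x y where xy: "\<And>i. i < d \<Longrightarrow> x i \<in> A i" "\<And>i. i < d \<Longrightarrow> y i \<in> A i" "\<And>i. i < d \<Longrightarrow> x i \<noteq> y i"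
    by metis
  define a b c where "a = restrict x {..<d}" and "b = restrict y {..<d}" and "c = a(0 := b 0)"
  have S: "a \<in> prod_states d A" "b \<in> prod_states d A" "c \<in> prod_states d A"
    using xy d by (auto simp: a_def b_def c_def PiE_iff extensional_def)
  \<comment> \<open>\<open>c\<close> agrees with \<open>b\<close> at coordinate 0 and with
    \<open>a\<close> elsewhere; coordinate 1, which exists because \<open>2 \<le> d\<close>, tells
    it apart from \<open>b\<close>.\<close>
  have "c 0 \<noteq> a 0" "c 1 \<noteq> b 1"
    using xy(3)[of 0] xy(3)[of 1] d by (auto simp: a_def b_def c_def)
  then have c: "c \<notin> {a, b}" by auto
  let ?Q = "pmf_of_set {a, b}"
  show thesis
  proof (rule that[of ?Q])
    show "is_kernel (prod_states d A) (\<lambda>_. ?Q)"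
      using S by (simp add: is_kernel_def)
    fix M :: "(nat \<Rightarrow> 'a) mrp"
    assume t: "trans M = (\<lambda>_. ?Q)"
    show "M \<notin> decoupled d A"
    proof
      assume "M \<in> decoupled d A"
      then obtain N where "\<forall>i<d. N i \<in> mrps (A i)"
        and P: "\<forall>s\<in>prod_states d A. \<forall>s'\<in>prod_states d A.
          pmf (trans M s) s' = (\<Prod>i<d. pmf (trans (N i) (s i)) (s' i))"
        and "\<forall>s\<in>prod_states d A. \<forall>s'\<in>prod_states d A.
          mean_rew M s s' = (\<Sum>i<d. mean_rew (N i) (s i) (s' i))"
        by (rule decoupledE)
      from bspec[OF P S(1)] have N: "pmf ?Q s' = (\<Prod>i<d. pmf (trans (N i) (a i)) (s' i))"
        if "s' \<in> prod_states d A" for s'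
        using that unfolding t by (rule bspec)
      have Q: "pmf ?Q a \<noteq> 0" "pmf ?Q b \<noteq> 0" "pmf ?Q c = 0"
        using c by (auto simp: set_pmf_eq[symmetric] simp flip: set_pmf_iff)
      have a: "\<forall>i<d. pmf (trans (N i) (a i)) (a i) \<noteq> 0"
        using Q(1) unfolding N[OF S(1)] by simp
      have b: "\<forall>i<d. pmf (trans (N i) (a i)) (b i) \<noteq> 0"
        using Q(2) unfolding N[OF S(2)] by simp
      have "\<exists>i<d. pmf (trans (N i) (a i)) (c i) = 0"
        using Q(3) unfolding N[OF S(3)] by auto
      then obtain i where i: "i < d" "pmf (trans (N i) (a i)) (c i) = 0"
        by blast
      have "c i = a i \<or> c i = b i"
        by (simp add: c_def)
      then show False
        using a b i by auto
    qed
  qed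
qed

text \<open>The guards for \<open>\<gamma> = 1\<close> account for values that may fail to exist.
  Strictness is restricted because with one factor every process is decoupled, and with
  \<open>n = 1\<close> there is a single state. Requiring a member of \<open>mrps_with S P r\<close>
  with defined value rules out a vacuous choice of \<open>r\<close>.\<close>

theorem theorem4p3:
  fixes \<gamma> :: real and d n :: nat and A :: "nat \<Rightarrow> 'a set" and S :: "(nat \<Rightarrow> 'a) set"
  assumes "0 < \<gamma>" and "\<gamma> \<le> 1"
    and "\<forall>i<d. finite (A i) \<and> card (A i) = n"
    and "S = prod_states d A"
  shows
    "{M \<in> decoupled d A. \<gamma> = 1 \<longrightarrow> value_defined \<gamma> S M}
       \<subseteq> {M \<in> mrps S. value_defined \<gamma> S M \<and> value_fun \<gamma> S M \<in> separable d A}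
     \<and> (2 \<le> d \<and> 2 \<le> n \<longrightarrow>
          {M \<in> decoupled d A. \<gamma> = 1 \<longrightarrow> value_defined \<gamma> S M}
            \<subset> {M \<in> mrps S. value_defined \<gamma> S M \<and> value_fun \<gamma> S M \<in> separable d A})
     \<and> (\<forall>V\<in>separable d A. \<forall>P. is_kernel S P \<longrightarrow>
          (\<exists>r :: (nat \<Rightarrow> 'a) \<Rightarrow> real.
             (\<exists>M\<in>mrps_with S P r. value_defined \<gamma> S M) \<and>
             (\<forall>M\<in>mrps_with S P r. (\<gamma> = 1 \<longrightarrow> value_defined \<gamma> S M) \<longrightarrow>
                value_defined \<gamma> S M \<and> value_fun \<gamma> S M \<in> separable d A \<and>
                (\<gamma> < 1 \<longrightarrow> (\<forall>s\<in>S. value_fun \<gamma> S M s = V s)))))"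
proof (intro conjI impI ballI allI)
  have finS: "finite S"
    using assms(3,4) by (auto intro: finite_PiE)
  have defd: "value_defined \<gamma> S M" if "M \<in> mrps S" "\<gamma> = 1 \<longrightarrow> value_defined \<gamma> S M" for M
  proof (cases "\<gamma> = 1")
    case False
    interpret finite_mrp S M by unfold_locales fact+
    show ?thesis
      using False assms(1,2) by (intro value_defined_discounted) auto
  qed (use that in auto)
  let ?D = "{M \<in> decoupled d A. \<gamma> = 1 \<longrightarrow> value_defined \<gamma> S M}"
  let ?V = "{M \<in> mrps S. value_defined \<gamma> S M \<and> value_fun \<gamma> S M \<in> separable d A}"
  show sub: "?D \<subseteq> ?V"
  proof
    fix M assume M: "M \<in> ?D"
    then have "M \<in> mrps S"
      by (simp add: decoupled_def assms(4))
    moreover from this have "value_defined \<gamma> S M"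
      using M by (intro defd) auto
    moreover from this have "value_fun \<gamma> S M \<in> separable d A"
      using M assms unfolding assms(4) by (intro value_fun_decoupled) auto
    ultimately show "M \<in> ?V" by simp
  qed
  show "?D \<subset> ?V" if n: "2 \<le> d \<and> 2 \<le> n"
  proof -
    obtain Q where "is_kernel S (\<lambda>_. Q)" "\<And>M. trans M = (\<lambda>_. Q) \<Longrightarrow> M \<notin> decoupled d A"
      using coupled_kernel_exists[of d A] n assms(3,4) by metis
    then have "det_mrp (\<lambda>_. Q) (\<lambda>_. 0) \<in> ?V - ?D"
      by (simp add: det_mrp_in_mrps value_defined_zero_rewards value_fun_zero_rewards separable_zero)
    then show ?thesis
      using sub by blast
  qed
  fix V P assume V: "V \<in> separable d A" and P: "is_kernel S P"
  \<comment> \<open>For \<open>\<gamma> < 1\<close> this is the Bellman equation solved for the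
    rewards. For \<open>\<gamma> = 1\<close> the same formula would give the partial sums
    \<open>V - (K ^^ T) V\<close>, which need not converge to \<open>V\<close>, so zero is taken
    instead.\<close>
  define r where "r = (\<lambda>s. if \<gamma> = 1 then 0 else V s - \<gamma> * (\<Sum>s'\<in>S. pmf (P s) s' * V s'))"
  have "\<exists>M\<in>mrps_with S P r. value_defined \<gamma> S M"
  proof
    show mem: "det_mrp P r \<in> mrps_with S P r"
      using finS P by (rule det_mrp_in_mrps_with)
    show "value_defined \<gamma> S (det_mrp P r)"
      using mem by (intro defd) (auto simp: mrps_with_def r_def value_defined_zero_rewards)
  qed
  moreover have "value_defined \<gamma> S M \<and> value_fun \<gamma> S M \<in> separable d A \<and>
      (\<gamma> < 1 \<longrightarrow> (\<forall>s\<in>S. value_fun \<gamma> S M s = V s))"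
    if M: "M \<in> mrps_with S P r" and def1: "\<gamma> = 1 \<longrightarrow> value_defined \<gamma> S M" for M
  proof -
    have mrp: "M \<in> mrps S" and r: "\<And>s. s \<in> S \<Longrightarrow> trans M s = P s" "\<And>s. s \<in> S \<Longrightarrow> avg_rew S M s = r s"
      using M by (auto simp: mrps_with_def)
    interpret finite_mrp S M by unfold_locales fact+
    have vd: "value_defined \<gamma> S M"
      using mrp def1 by (rule defd)
    show ?thesis
    proof (cases "\<gamma> = 1")
      case True
      have "value_fun \<gamma> S M s = 0" if s: "s \<in> S" for s
      proof -
        \<comment> \<open>Zero average rewards do not make the single mean rewards vanish, so
          \<open>value_fun_zero_rewards\<close> does not apply; the limit formula does, with all
          partial sums 0.\<close>
        have "(K ^^ t) (avg_rew S M) s = (K ^^ t) (\<lambda>_. 0) s" for t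
          using r(2) s True by (intro K_pow_cong) (auto simp: r_def)
        then show ?thesis
          using value_fun_limit[OF vd _ _ s] s assms(1,2) by (simp add: K_pow_const LIMSEQ_const_iff)
      qed
      then have "value_fun \<gamma> S M \<in> separable d A"
        unfolding assms(4) by (rule separable_zero)
      then show ?thesis
        using vd True by simp
    next
      case False
      have eq: "value_fun \<gamma> S M s = V s" if s: "s \<in> S" for s
      proof -
        \<comment> \<open>The value function and \<open>V\<close> solve the Bellman equation for the
          same \<open>r\<close>, so their difference solves the homogeneous one.\<close>
        have "value_fun \<gamma> S M s - V s = 0"
        proof (rule discounted_fixpoint_unique[of \<gamma> "\<lambda>s. value_fun \<gamma> S M s - V s"])
          fix s assume s: "s \<in> S"
          have "K (\<lambda>s. value_fun \<gamma> S M s - V s) s = K (value_fun \<gamma> S M) s - K V s"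
            using K_add_scaled[of "value_fun \<gamma> S M" "-1" V] by (simp add: fun_eq_iff)
          then show "value_fun \<gamma> S M s - V s = \<gamma> * K (\<lambda>s. value_fun \<gamma> S M s - V s) s"
            using value_fun_bellman[OF vd s] r[OF s] False by (simp add: r_def K_def right_diff_distrib)
        qed (use assms(1,2) False s in auto)
        then show ?thesis by simp
      qed
      moreover have "value_fun \<gamma> S M \<in> separable d A"
        using V eq by (auto simp: separable_def assms(4))
      ultimately show ?thesis
        using vd by simp
    qed
  qed
  ultimately show "\<exists>r. (\<exists>M\<in>mrps_with S P r. value_defined \<gamma> S M) \<and>
      (\<forall>M\<in>mrps_with S P r. (\<gamma> = 1 \<longrightarrow> value_defined \<gamma> S M) \<longrightarrow>
        value_defined \<gamma> S M \<and> value_fun \<gamma> S M \<in> separable d A \<and>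
        (\<gamma> < 1 \<longrightarrow> (\<forall>s\<in>S. value_fun \<gamma> S M s = V s)))"
    by blast
qed

end
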